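(* For any unimodal range map $\delta$, if $\delta$ is not $1$-dominated, then the space $\mathcal{R}_\delta$ of the nontrivial relations of $\mathbf{Cl}_\delta$ is not finitely generated.
   Context: $\mathbb{N}=\{0,1,2,\dots\}$ and $\mathbb{K}$ is a field of characteristic zero. A range map is a map $\delta:\mathbb{N}\setminus\{0\}\to\mathbb{N}$. It is unimodal if there are no $1\le i_1<i_2<i_3$ with $\delta(i_1)>\delta(i_2)<\delta(i_3)$. It is $1$-dominated if there is a $k\ge1$ such that $\delta(1)\ge\delta(k')$ for all $k'\ge k$. For a word $w$ on $\mathbb{N}$, $\ell(w)$ is its length, $w(i)$ its $i$-th letter, $\epsilon$ is the empty word. A $\delta$-cliff is a word $w$ on $\mathbb{N}$ with $0\le w(i)\le\delta(i)$ for all $i$; its size is $|w|:=\ell(w)+1$; $\mathsf{Cl}_\delta$ is the graded set of all $\delta$-cliffs. For words $u,v$ and $1\le i\le|u|$, $u\,\square_i\,v:=u(1)\cdots u(i-1)\;v\;u(i)\cdots u(\ell(u))$. For $\delta$ unimodal, $\mathbf{Cl}_\delta$ is the nonsymmetric operad over $\mathbb{K}$ with basis $\{\mathsf{E}_w:w\in\mathsf{Cl}_\delta\}$ ($\mathsf{E}_w$ of arity $|w|$), partial compositions $\mathsf{E}_u\circ_i\mathsf{E}_v=\mathsf{E}_{u\,\square_i\,v}$ if $u\,\square_i\,v\in\mathsf{Cl}_\delta$ and $\mathsf{E}_u\circ_i\mathsf{E}_v=0$ otherwise, and unit $\mathsf{E}_\epsilon$. A nonempty $\delta$-cliff $w$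 is $\delta$-prime if $w=u\,\square_i\,v$ with $u,v\in\mathsf{Cl}_\delta$ and $1\le i\le|u|$ implies $(u,v)\in\{(w,\epsilon),(\epsilon,w)\}$. Let $\mathfrak{G}_\delta:=\{\mathsf{E}_w:w \text{ a } \delta\text{-prime } \delta\text{-cliff}\}$, which is a minimal generating set of $\mathbf{Cl}_\delta$. The nontrivial relations of $\mathbf{Cl}_\delta$ are those of its presentation with generating set $\mathfrak{G}_\delta$, i.e. the elements of the kernel of the canonical surjective operad morphism from the free nonsymmetric operad on $\mathfrak{G}_\delta$ to $\mathbf{Cl}_\delta$; "not finitely generated" means that this kernel is not generated, as an operad ideal of the free operad, by any finite set of elements. *)

theory Defs
  imports Complex_Main "HOL-Library.Poly_Mapping"
begin

section \<open>Nonsymmetric operads\<close>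

text \<open>
  An operad is a family of subspaces \<open>component P n\<close> (the elements of arity \<open>n\<close>) of an ambient
  vector space, with partial compositions \<open>pcomp P i x y\<close> standing for the composition of \<open>y\<close> at
  the \<open>i\<close>-th input of \<open>x\<close>; inputs are numbered from 1.
\<close>

record ('k, 'a) operad_data =
  scale :: "'k \<Rightarrow> 'a \<Rightarrow> 'a"
  component :: "nat \<Rightarrow> 'a set"
  pcomp :: "nat \<Rightarrow> 'a \<Rightarrow> 'a \<Rightarrow> 'a"
  op_unit :: 'a

locale ns_operad =
  fixes P :: "('k::field, 'a::ab_group_add) operad_data"
  assumes vector_space_scale: "vector_space (scale P)"
    and component_subspace: "module.subspace (scale P) (component P n)"
    and unit_closed: "op_unit P \<in> component P 1"
    and pcomp_closed:
      "\<lbrakk>x \<in> component P m; y \<in> component P n; 1 \<le> i; i \<le> m\<rbrakk>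
        \<Longrightarrow> pcomp P i x y \<in> component P (m + n - 1)"
    and pcomp_add_left:
      "\<lbrakk>x \<in> component P m; x' \<in> component P m; y \<in> component P n; 1 \<le> i; i \<le> m\<rbrakk>
        \<Longrightarrow> pcomp P i (x + x') y = pcomp P i x y + pcomp P i x' y"
    and pcomp_add_right:
      "\<lbrakk>x \<in> component P m; y \<in> component P n; y' \<in> component P n; 1 \<le> i; i \<le> m\<rbrakk>
        \<Longrightarrow> pcomp P i x (y + y') = pcomp P i x y + pcomp P i x y'"
    and pcomp_scale_left:
      "\<lbrakk>x \<in> component P m; y \<in> component P n; 1 \<le> i; i \<le> m\<rbrakk>
        \<Longrightarrow> pcomp P i (scale P c x) y = scale P c (pcomp P i x y)"
    and pcomp_scale_right:
      "\<lbrakk>x \<in> component P m; y \<in> component P n; 1 \<le> i; i \<le> m\<rbrakk>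
        \<Longrightarrow> pcomp P i x (scale P c y) = scale P c (pcomp P i x y)"
    and unit_left: "x \<in> component P m \<Longrightarrow> pcomp P 1 (op_unit P) x = x"
    and unit_right: "\<lbrakk>x \<in> component P m; 1 \<le> i; i \<le> m\<rbrakk> \<Longrightarrow> pcomp P i x (op_unit P) = x"
    and sequential_assoc:
      "\<lbrakk>x \<in> component P l; y \<in> component P m; z \<in> component P n; 1 \<le> i; i \<le> l; 1 \<le> j; j \<le> m\<rbrakk>
        \<Longrightarrow> pcomp P (i + j - 1) (pcomp P i x y) z = pcomp P i x (pcomp P j y z)"
    and parallel_assoc:
      "\<lbrakk>x \<in> component P l; y \<in> component P m; z \<in> component P n; 1 \<le> i; i < j; j \<le> l\<rbrakk>
        \<Longrightarrow> pcomp P (j + m - 1) (pcomp P i x y) z = pcomp P i (pcomp P j x z) y"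

text \<open>Operad ideals are graded; \<open>I n\<close> is the part of arity \<open>n\<close>.\<close>

definition operad_ideal ::
    "('k::field, 'a::ab_group_add) operad_data \<Rightarrow> (nat \<Rightarrow> 'a set) \<Rightarrow> bool" where
  "operad_ideal P I \<longleftrightarrow>
    (\<forall>n. I n \<subseteq> component P n \<and> module.subspace (scale P) (I n)) \<and>
    (\<forall>m n i. \<forall>x \<in> component P m. \<forall>y \<in> component P n.
      1 \<le> i \<and> i \<le> m \<and> (x \<in> I m \<or> y \<in> I n) \<longrightarrow> pcomp P i x y \<in> I (m + n - 1))"

definition generated_ideal ::
    "('k::field, 'a::ab_group_add) operad_data \<Rightarrow> 'a set \<Rightarrow> nat \<Rightarrow> 'a set" where
  "generated_ideal P X n =
    \<Inter> {I n | I. operad_ideal P I \<and> (\<forall>m. X \<inter> component P m \<subseteq> I m)}"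

definition finitely_generated_ideal ::
    "('k::field, 'a::ab_group_add) operad_data \<Rightarrow> (nat \<Rightarrow> 'a set) \<Rightarrow> bool" where
  "finitely_generated_ideal P I \<longleftrightarrow>
    (\<exists>X. finite X \<and> X \<subseteq> (\<Union>n. component P n) \<and> I = generated_ideal P X)"


section \<open>Linearization\<close>

definition pm_scale :: "'k::field \<Rightarrow> ('b \<Rightarrow>\<^sub>0 'k) \<Rightarrow> ('b \<Rightarrow>\<^sub>0 'k)" where
  "pm_scale c = Poly_Mapping.map ((*) c)"

definition linear_ext ::
    "('k \<Rightarrow> 'a \<Rightarrow> 'a) \<Rightarrow> ('b \<Rightarrow> 'a) \<Rightarrow> ('b \<Rightarrow>\<^sub>0 'k::field) \<Rightarrow> 'a::ab_group_add" where
  "linear_ext sc h f = (\<Sum>t\<in>Poly_Mapping.keys f. sc (Poly_Mapping.lookup f t) (h t))"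

definition bilinear_ext ::
    "('b \<Rightarrow> 'b \<Rightarrow> 'b option) \<Rightarrow> ('b \<Rightarrow>\<^sub>0 'k::field) \<Rightarrow> ('b \<Rightarrow>\<^sub>0 'k) \<Rightarrow> ('b \<Rightarrow>\<^sub>0 'k)" where
  "bilinear_ext b f g = linear_ext pm_scale (\<lambda>s. linear_ext pm_scale (\<lambda>t.
    case b s t of None \<Rightarrow> 0 | Some r \<Rightarrow> Poly_Mapping.single r 1) g) f"

text \<open>
  The operad with basis \<open>B\<close>, graded by \<open>d\<close>, in which the composition of two basis elements is a
  basis element or zero (encoded by \<open>None\<close>).
\<close>

definition linearized_operad ::
    "'b set \<Rightarrow> ('b \<Rightarrow> nat) \<Rightarrow> (nat \<Rightarrow> 'b \<Rightarrow> 'b \<Rightarrow> 'b option) \<Rightarrow> 'b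
      \<Rightarrow> ('k::field, 'b \<Rightarrow>\<^sub>0 'k) operad_data" where
  "linearized_operad B d b e = \<lparr>
    scale = pm_scale,
    component = (\<lambda>n. {f. \<forall>t \<in> Poly_Mapping.keys f. t \<in> B \<and> d t = n}),
    pcomp = (\<lambda>i. bilinear_ext (b i)),
    op_unit = Poly_Mapping.single e 1\<rparr>"


section \<open>Free operads and presentations\<close>

text \<open>Planar rooted trees; the arity of an internal node is its number of children.\<close>

datatype 'g stree = Leaf | Node 'g "'g stree list"

primrec leaves :: "'g stree \<Rightarrow> nat" where
  "leaves Leaf = 1"
| "leaves (Node g ts) = sum_list (map leaves ts)"

primrec syntax_tree :: "(nat \<Rightarrow> 'g set) \<Rightarrow> 'g stree \<Rightarrow> bool" where
  "syntax_tree G Leaf \<longleftrightarrow> True"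
| "syntax_tree G (Node g ts) \<longleftrightarrow> g \<in> G (length ts) \<and> list_all (syntax_tree G) ts"

text \<open>\<open>graft i s t\<close> grafts \<open>t\<close> onto the \<open>i\<close>-th leaf of \<open>s\<close>, leaves being numbered from left to right.\<close>

fun graft :: "nat \<Rightarrow> 'g stree \<Rightarrow> 'g stree \<Rightarrow> 'g stree"
  and graft_list :: "nat \<Rightarrow> 'g stree list \<Rightarrow> 'g stree \<Rightarrow> 'g stree list" where
  "graft i Leaf t = t"
| "graft i (Node g ss) t = Node g (graft_list i ss t)"
| "graft_list i [] t = []"
| "graft_list i (s # ss) t =
    (if i \<le> leaves s then graft i s t # ss else s # graft_list (i - leaves s) ss t)"

definition free_operad ::
    "(nat \<Rightarrow> 'g set) \<Rightarrow> ('k::field, 'g stree \<Rightarrow>\<^sub>0 'k) operad_data" where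
  "free_operad G =
    linearized_operad {t. syntax_tree G t} leaves (\<lambda>i s t. Some (graft i s t)) Leaf"

text \<open>
  The full composition of \<open>x\<close>, of arity \<open>k\<close>, with \<open>y\<^sub>1, \<dots>, y\<^sub>k\<close>: the compositions are performed
  from the last input to the first, so that the positions of the remaining inputs do not change.
\<close>

definition full_comp :: "('k, 'a) operad_data \<Rightarrow> 'a \<Rightarrow> 'a list \<Rightarrow> 'a" where
  "full_comp P x ys = foldr (\<lambda>(i, y) z. pcomp P i z y) (zip [1..<Suc (length ys)] ys) x"

primrec eval_tree :: "('k, 'a) operad_data \<Rightarrow> 'a stree \<Rightarrow> 'a" where
  "eval_tree P Leaf = op_unit P"
| "eval_tree P (Node g ts) = full_comp P g (map (eval_tree P) ts)"

text \<open>
  For a graded set \<open>G\<close> of elements of \<open>P\<close>, this is the operad morphism from \<open>free_operad G\<close> to \<open>P\<close>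
  that sends every element of \<open>G\<close> to itself.
\<close>

definition canonical_morphism ::
    "('k::field, 'a::ab_group_add) operad_data \<Rightarrow> ('a stree \<Rightarrow>\<^sub>0 'k) \<Rightarrow> 'a" where
  "canonical_morphism P = linear_ext (scale P) (eval_tree P)"

definition relations ::
    "('k::field, 'a::ab_group_add) operad_data \<Rightarrow> (nat \<Rightarrow> 'a set) \<Rightarrow> nat \<Rightarrow> ('a stree \<Rightarrow>\<^sub>0 'k) set" where
  "relations P G n = {f \<in> component (free_operad G) n. canonical_morphism P f = 0}"


section \<open>Cliffs\<close>

text \<open>
  A range map is a function \<open>\<delta>\<close> on the positive integers; the value \<open>\<delta> 0\<close> is never used. The
  \<open>i\<close>-th letter of a word \<open>w\<close> is \<open>w ! (i - 1)\<close>.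
\<close>

definition unimodal :: "(nat \<Rightarrow> nat) \<Rightarrow> bool" where
  "unimodal \<delta> \<longleftrightarrow>
    \<not> (\<exists>i1 i2 i3. 1 \<le> i1 \<and> i1 < i2 \<and> i2 < i3 \<and> \<delta> i1 > \<delta> i2 \<and> \<delta> i2 < \<delta> i3)"

definition one_dominated :: "(nat \<Rightarrow> nat) \<Rightarrow> bool" where
  "one_dominated \<delta> \<longleftrightarrow> (\<exists>k\<ge>1. \<forall>k'\<ge>k. \<delta> 1 \<ge> \<delta> k')"

definition cliffs :: "(nat \<Rightarrow> nat) \<Rightarrow> nat list set" where
  "cliffs \<delta> = {w. \<forall>i. 1 \<le> i \<and> i \<le> length w \<longrightarrow> w ! (i - 1) \<le> \<delta> i}"

definition cliff_size :: "nat list \<Rightarrow> nat" where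
  "cliff_size w = length w + 1"

definition insert_word :: "nat \<Rightarrow> nat list \<Rightarrow> nat list \<Rightarrow> nat list" where
  "insert_word i u v = take (i - 1) u @ v @ drop (i - 1) u"

definition cliff_operad :: "(nat \<Rightarrow> nat) \<Rightarrow> ('k::field, nat list \<Rightarrow>\<^sub>0 'k) operad_data" where
  "cliff_operad \<delta> = linearized_operad (cliffs \<delta>) cliff_size
    (\<lambda>i u v. if insert_word i u v \<in> cliffs \<delta> then Some (insert_word i u v) else None) []"

definition prime_cliff :: "(nat \<Rightarrow> nat) \<Rightarrow> nat list \<Rightarrow> bool" where
  "prime_cliff \<delta> w \<longleftrightarrow> w \<in> cliffs \<delta> \<and> w \<noteq> [] \<and>
    (\<forall>u \<in> cliffs \<delta>. \<forall>v \<in> cliffs \<delta>. \<forall>i. 1 \<le> i \<and> i \<le> cliff_size u \<and> w = insert_word i u v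
      \<longrightarrow> (u, v) \<in> {(w, []), ([], w)})"

text \<open>The generating set, graded by arity; \<open>Poly_Mapping.single w 1\<close> is the basis element of \<open>w\<close>.\<close>

definition cliff_generators :: "(nat \<Rightarrow> nat) \<Rightarrow> nat \<Rightarrow> (nat list \<Rightarrow>\<^sub>0 'k::field) set" where
  "cliff_generators \<delta> n =
    {Poly_Mapping.single w 1 | w. prime_cliff \<delta> w \<and> cliff_size w = n}"

definition nontrivial_relations ::
    "(nat \<Rightarrow> nat) \<Rightarrow> nat \<Rightarrow> ((nat list \<Rightarrow>\<^sub>0 'k) stree \<Rightarrow>\<^sub>0 'k::field) set" where
  "nontrivial_relations \<delta> = relations (cliff_operad \<delta>) (cliff_generators \<delta>)"


section \<open>The free operad and the cliff operad are operads\<close>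

lemma lookup_pm_scale [simp]: "Poly_Mapping.lookup (pm_scale c f) t = c * Poly_Mapping.lookup f t"
  unfolding pm_scale_def by (simp add: Poly_Mapping.map.rep_eq when_def)

lemma vector_space_pm_scale: "vector_space (pm_scale :: 'k::field \<Rightarrow> ('b \<Rightarrow>\<^sub>0 'k) \<Rightarrow> _)"
  by unfold_locales (auto intro!: poly_mapping_eqI simp: lookup_add algebra_simps)

lemma linear_ext_superset:
  assumes "vector_space sc" "finite A" "Poly_Mapping.keys f \<subseteq> A"
  shows "linear_ext sc h f = (\<Sum>t\<in>A. sc (Poly_Mapping.lookup f t) (h t))"
proof -
  interpret vector_space sc by fact
  show ?thesis unfolding linear_ext_def
    by (rule sum.mono_neutral_left) (use assms in \<open>auto simp: in_keys_iff\<close>)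
qed

lemma linear_ext_add:
  assumes "vector_space sc"
  shows "linear_ext sc h (f + g) = linear_ext sc h f + linear_ext sc h g"
proof -
  interpret vector_space sc by fact
  let ?A = "Poly_Mapping.keys f \<union> Poly_Mapping.keys g"
  have *: "linear_ext sc h k = (\<Sum>t\<in>?A. sc (Poly_Mapping.lookup k t) (h t))"
    if "Poly_Mapping.keys k \<subseteq> ?A" for k
    by (rule linear_ext_superset[OF assms _ that]) simp
  show ?thesis
    by (simp add: *[OF keys_add] *[OF Un_upper1] *[OF Un_upper2]
        lookup_add scale_left_distrib sum.distrib)
qed

lemma linear_ext_scale:
  assumes "vector_space sc"
  shows "linear_ext sc h (pm_scale c f) = sc c (linear_ext sc h f)"
proof -
  interpret vector_space sc by fact
  have "Poly_Mapping.keys (pm_scale c f) \<subseteq> Poly_Mapping.keys f"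
    by (auto simp: in_keys_iff)
  then show ?thesis
    by (simp add: linear_ext_superset[OF assms finite_keys] linear_ext_def[of sc h f] scale_sum_right)
qed

lemma linear_ext_single:
  assumes "vector_space sc"
  shows "linear_ext sc h (Poly_Mapping.single t c) = sc c (h t)"
proof -
  interpret vector_space sc by fact
  show ?thesis by (subst linear_ext_superset[OF assms, of "{t}"]) auto
qed

lemma linear_ext_fun_add:
  assumes "vector_space sc"
  shows "linear_ext sc (\<lambda>t. h t + h' t) f = linear_ext sc h f + linear_ext sc h' f"
proof -
  interpret vector_space sc by fact
  show ?thesis unfolding linear_ext_def by (simp add: scale_right_distrib sum.distrib)
qed

lemma linear_ext_fun_scale:
  assumes "vector_space sc"
  shows "linear_ext sc (\<lambda>t. sc c (h t)) f = sc c (linear_ext sc h f)"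
proof -
  interpret vector_space sc by fact
  show ?thesis unfolding linear_ext_def by (simp add: scale_sum_right mult.commute)
qed

lemma linear_ext_zero [simp]: "linear_ext sc h 0 = 0"
  unfolding linear_ext_def by simp

lemma pm_scale_single [simp]: "pm_scale c (Poly_Mapping.single t d) = Poly_Mapping.single t (c * d)"
  by (rule poly_mapping_eqI) (simp add: lookup_single when_def)

lemma pm_scale_zero [simp]: "pm_scale c 0 = 0"
  by (rule poly_mapping_eqI) simp

lemma pm_component_induct [consumes 1, case_names 1 2 3]:
  fixes f :: "'b \<Rightarrow>\<^sub>0 'k::field"
  assumes S: "Poly_Mapping.keys f \<subseteq> S" and Z: "P 0" and one: "\<And>t c. t \<in> S \<Longrightarrow> P (Poly_Mapping.single t c)"
    and A: "\<And>f g. Poly_Mapping.keys f \<subseteq> S \<Longrightarrow> Poly_Mapping.keys g \<subseteq> S \<Longrightarrow> P f \<Longrightarrow> P g \<Longrightarrow> P (f + g)"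
  shows "P f"
proof -
  have "Poly_Mapping.keys (\<Sum>t\<in>T. Poly_Mapping.single t (Poly_Mapping.lookup f t)) \<subseteq> S
     \<and> P (\<Sum>t\<in>T. Poly_Mapping.single t (Poly_Mapping.lookup f t))" if "finite T" "T \<subseteq> S" for T
    using that
  proof (induction T rule: finite_induct)
    case empty then show ?case by (simp add: Z)
  next
    case (insert x T)
    let ?a = "Poly_Mapping.single x (Poly_Mapping.lookup f x)"
    let ?b = "\<Sum>t\<in>T. Poly_Mapping.single t (Poly_Mapping.lookup f t)"
    have xT: "x \<in> S" "T \<subseteq> S" using insert.prems by simp_all
    have IH: "Poly_Mapping.keys ?b \<subseteq> S" "P ?b" using insert.IH[OF xT(2)] by simp_all
    have a: "Poly_Mapping.keys ?a \<subseteq> S" "P ?a" using xT(1) one[OF xT(1)] by simp_all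
    have "Poly_Mapping.keys (?a + ?b) \<subseteq> S"
      by (rule subset_trans[OF keys_add Un_least[OF a(1) IH(1)]])
    moreover have "P (?a + ?b)" by (rule A[OF a(1) IH(1) a(2) IH(2)])
    ultimately show ?case using insert(1,2) by simp
  qed
  from this[OF finite_keys S]
  have "P (\<Sum>t\<in>Poly_Mapping.keys f. Poly_Mapping.single t (Poly_Mapping.lookup f t))" by (rule conjunct2)
  also have "(\<Sum>t\<in>Poly_Mapping.keys f. Poly_Mapping.single t (Poly_Mapping.lookup f t)) = f"
    by (rule poly_mapping_eqI)
      (simp add: lookup_sum lookup_single when_def sum.If_cases in_keys_iff sum.delta')
  finally show ?thesis .
qed

lemma bilinear_ext_add_left: "bilinear_ext b (f+f') g = bilinear_ext b f g + bilinear_ext b f' g"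
  unfolding bilinear_ext_def by (rule linear_ext_add[OF vector_space_pm_scale])

lemma bilinear_ext_add_right: "bilinear_ext b f (g+g') = bilinear_ext b f g + bilinear_ext b f g'"
  unfolding bilinear_ext_def
  by (simp add: linear_ext_add[OF vector_space_pm_scale] linear_ext_fun_add[OF vector_space_pm_scale])

lemma bilinear_ext_scale_left: "bilinear_ext b (pm_scale c f) g = pm_scale c (bilinear_ext b f g)"
  unfolding bilinear_ext_def by (rule linear_ext_scale[OF vector_space_pm_scale])

lemma bilinear_ext_scale_right: "bilinear_ext b f (pm_scale c g) = pm_scale c (bilinear_ext b f g)"
  unfolding bilinear_ext_def
  by (simp add: linear_ext_scale[OF vector_space_pm_scale] linear_ext_fun_scale[OF vector_space_pm_scale])

lemma bilinear_ext_zero [simp]: "bilinear_ext b 0 g = 0" "bilinear_ext b f 0 = 0"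
  unfolding bilinear_ext_def by (auto simp: linear_ext_def)

lemma bilinear_ext_single: "bilinear_ext b (Poly_Mapping.single s c) (Poly_Mapping.single t d) =
   (case b s t of None \<Rightarrow> 0 | Some r \<Rightarrow> Poly_Mapping.single r (c * d))"
  unfolding bilinear_ext_def by (auto simp: linear_ext_single[OF vector_space_pm_scale] split: option.split)

lemma ns_operad_linearized_operad:
  assumes e: "e \<in> B" "d e = 1"
   and cl: "\<And>i s t r. s \<in> B \<Longrightarrow> t \<in> B \<Longrightarrow> 1 \<le> i \<Longrightarrow> i \<le> d s \<Longrightarrow> b i s t = Some r \<Longrightarrow> r \<in> B \<and> d r = d s + d t - 1"
   and ul: "\<And>t. t \<in> B \<Longrightarrow> b 1 e t = Some t"
   and ur: "\<And>i t. t \<in> B \<Longrightarrow> 1 \<le> i \<Longrightarrow> i \<le> d t \<Longrightarrow> b i t e = Some t"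
   and sa: "\<And>i j s t u. s \<in> B \<Longrightarrow> t \<in> B \<Longrightarrow> u \<in> B \<Longrightarrow> 1 \<le> i \<Longrightarrow> i \<le> d s \<Longrightarrow> 1 \<le> j \<Longrightarrow> j \<le> d t \<Longrightarrow>
      Option.bind (b i s t) (\<lambda>r. b (i + j - 1) r u) = Option.bind (b j t u) (b i s)"
   and pa: "\<And>i j s t u. s \<in> B \<Longrightarrow> t \<in> B \<Longrightarrow> u \<in> B \<Longrightarrow> 1 \<le> i \<Longrightarrow> i < j \<Longrightarrow> j \<le> d s \<Longrightarrow>
      Option.bind (b i s t) (\<lambda>r. b (j + d t - 1) r u) = Option.bind (b j s u) (\<lambda>r. b i r t)"
  shows "ns_operad (linearized_operad B d b e :: ('k::field, _) operad_data)"
proof -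
  let ?C = "\<lambda>n. {f :: 'a \<Rightarrow>\<^sub>0 'k. Poly_Mapping.keys f \<subseteq> {t \<in> B. d t = n}}"
  have comp: "component (linearized_operad B d b e :: ('k::field, _) operad_data) n = ?C n" for n
    unfolding linearized_operad_def by auto
  have pc: "pcomp (linearized_operad B d b e) i = (bilinear_ext (b i) :: _ \<Rightarrow> _ \<Rightarrow> _ \<Rightarrow>\<^sub>0 'k)" for i
    unfolding linearized_operad_def by (auto simp: bilinear_ext_def fun_eq_iff)
  have sc: "scale (linearized_operad B d b e) = (pm_scale :: 'k \<Rightarrow> _)"
    unfolding linearized_operad_def by simp
  have un: "op_unit (linearized_operad B d b e) = Poly_Mapping.single e (1::'k)"
    unfolding linearized_operad_def by simp
  interpret V: vector_space "pm_scale :: 'k \<Rightarrow> ('a \<Rightarrow>\<^sub>0 'k) \<Rightarrow> _" by (rule vector_space_pm_scale)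
  have sub: "V.subspace (?C n)" for n
  proof (rule V.subspaceI)
    fix f g assume "f \<in> ?C n" "g \<in> ?C n"
    then show "f + g \<in> ?C n" using keys_add[of f g] by blast
  next
    fix c f assume "f \<in> ?C n"
    moreover have "Poly_Mapping.keys (pm_scale c f) \<subseteq> Poly_Mapping.keys f"
      by (auto simp: in_keys_iff)
    ultimately show "pm_scale c f \<in> ?C n" by blast
  qed simp
  show ?thesis
  proof (rule ns_operad.intro, unfold comp pc sc un, goal_cases)
    case 1 show ?case by (rule vector_space_pm_scale)
  next
    case (2 n) show ?case by (rule sub)
  next
    case 3 show ?case using e by auto
  next
    case (4 x m y n i)
    have "Poly_Mapping.keys x \<subseteq> {t \<in> B. d t = m}" "Poly_Mapping.keys y \<subseteq> {t \<in> B. d t = n}" using 4 by auto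
    then show ?case
    proof (induction x rule: pm_component_induct)
      case (2 s c)
      then have s: "s \<in> B" "d s = m" by auto
      from 2(2) show ?case
      proof (induction y rule: pm_component_induct)
        case 1 then show ?case using V.subspace_0[OF sub] by simp
      next
        case (2 t c')
        then show ?case using cl[of s t i] s \<open>1 \<le> i\<close> \<open>i \<le> m\<close> by (auto simp: bilinear_ext_single split: option.split)
      next
        case (3 f g) then show ?case unfolding bilinear_ext_add_right by (intro V.subspace_add[OF sub])
      qed
    next
      case 1 then show ?case using V.subspace_0[OF sub] by simp
    next
      case (3 f g) then show ?case unfolding bilinear_ext_add_left by (intro V.subspace_add[OF sub])
    qed
  next
    case (9 x m)
    then have "Poly_Mapping.keys x \<subseteq> {t \<in> B. d t = m}" by simp
    then show ?case
      by (induction x rule: pm_component_induct) (auto simp: bilinear_ext_add_right bilinear_ext_single ul[simplified])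
  next
    case (10 x m i)
    then have "Poly_Mapping.keys x \<subseteq> {t \<in> B. d t = m}" by simp
    then show ?case
      by (induction x rule: pm_component_induct) (use 10 in \<open>auto simp: bilinear_ext_add_left bilinear_ext_single ur[simplified]\<close>)
  next
    case (11 x l y m z n i j)
    have "Poly_Mapping.keys x \<subseteq> {t \<in> B. d t = l}" using 11 by simp
    then show ?case
    proof (induction x rule: pm_component_induct)
      case (2 s c)
      have "Poly_Mapping.keys y \<subseteq> {t \<in> B. d t = m}" using 11 by simp
      then show ?case
      proof (induction y rule: pm_component_induct)
        case (2 t c')
        have "Poly_Mapping.keys z \<subseteq> {t \<in> B. d t = n}" using 11 by simp
        then show ?case
        proof (induction z rule: pm_component_induct)
          case (2 u c'')
          have "Option.bind (b i s t) (\<lambda>r. b (i + j - 1) r u) = Option.bind (b j t u) (b i s)"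
            using sa[of s t u i j] 2 \<open>s \<in> _\<close> \<open>t \<in> _\<close> 11 by auto
          then show ?case
            by (cases "b i s t"; cases "b j t u") (auto simp: bilinear_ext_single mult.assoc split: option.splits)
        qed (simp_all add: bilinear_ext_add_right bilinear_ext_add_left)
      qed (simp_all add: bilinear_ext_add_right bilinear_ext_add_left)
    qed (simp_all add: bilinear_ext_add_right bilinear_ext_add_left)
  next
    case (12 x l y m z n i j)
    have "Poly_Mapping.keys x \<subseteq> {t \<in> B. d t = l}" using 12 by simp
    then show ?case
    proof (induction x rule: pm_component_induct)
      case (2 s c)
      have "Poly_Mapping.keys y \<subseteq> {t \<in> B. d t = m}" using 12 by simp
      then show ?case
      proof (induction y rule: pm_component_induct)
        case (2 t c')
        have "Poly_Mapping.keys z \<subseteq> {t \<in> B. d t = n}" using 12 by simp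
        then show ?case
        proof (induction z rule: pm_component_induct)
          case (2 u c'')
          have "Option.bind (b i s t) (\<lambda>r. b (j + m - 1) r u) = Option.bind (b j s u) (\<lambda>r. b i r t)"
            using pa[of s t u i j] 2 \<open>s \<in> _\<close> \<open>t \<in> _\<close> 12 by auto
          then show ?case
            by (cases "b i s t"; cases "b j s u") (auto simp: bilinear_ext_single mult_ac split: option.splits)
        qed (simp_all add: bilinear_ext_add_right bilinear_ext_add_left)
      qed (simp_all add: bilinear_ext_add_right bilinear_ext_add_left)
    qed (simp_all add: bilinear_ext_add_right bilinear_ext_add_left)
  qed (auto simp: bilinear_ext_add_left bilinear_ext_add_right bilinear_ext_scale_left bilinear_ext_scale_right)
qed

definition shifted_cliff :: "(nat \<Rightarrow> nat) \<Rightarrow> nat \<Rightarrow> nat list \<Rightarrow> bool" where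
  "shifted_cliff \<delta> p w \<longleftrightarrow> (\<forall>k<length w. w ! k \<le> \<delta> (p + k))"

lemma shifted_cliff_append: "shifted_cliff \<delta> p (u @ v) \<longleftrightarrow> shifted_cliff \<delta> p u \<and> shifted_cliff \<delta> (p + length u) v"
  unfolding shifted_cliff_def
proof safe
  fix k assume *: "\<forall>k<length (u @ v). (u @ v) ! k \<le> \<delta> (p + k)"
  { assume "k < length u" then show "u ! k \<le> \<delta> (p + k)" using *[rule_format, of k] by (simp add: nth_append) }
  assume "k < length v" then show "v ! k \<le> \<delta> (p + length u + k)"
    using *[rule_format, of "length u + k"] by (simp add: nth_append add.assoc)
next
  fix k assume "\<forall>k<length u. u ! k \<le> \<delta> (p + k)" "\<forall>k<length v. v ! k \<le> \<delta> (p + length u + k)" "k < length (u @ v)"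
  then show "(u @ v) ! k \<le> \<delta> (p + k)"
    by (cases "k < length u") (auto simp: nth_append dest!: spec[of _ "k - length u"])
qed

lemma cliffs_iff_shifted_cliff: "w \<in> cliffs \<delta> \<longleftrightarrow> shifted_cliff \<delta> 1 w"
proof -
  have "(\<forall>i. 1 \<le> i \<and> i \<le> length w \<longrightarrow> w ! (i - 1) \<le> \<delta> i) \<longleftrightarrow> (\<forall>k<length w. w ! k \<le> \<delta> (Suc k))"
    (is "?L = ?R")
  proof
    assume ?L then show ?R by (metis Suc_leI diff_Suc_1 le_add1 plus_1_eq_Suc)
  next
    assume R: ?R
    show ?L
    proof safe
      fix i assume "1 \<le> i" "i \<le> length w"
      then show "w ! (i - 1) \<le> \<delta> i" using R[rule_format, of "i - 1"] by simp
    qed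
  qed
  then show ?thesis unfolding cliffs_def shifted_cliff_def by simp
qed

lemma shifted_cliff_between:
  assumes "unimodal \<delta>" "shifted_cliff \<delta> p w" "shifted_cliff \<delta> r w" "1 \<le> p" "p \<le> q" "q \<le> r"
  shows "shifted_cliff \<delta> q w"
  unfolding shifted_cliff_def
proof safe
  fix k assume k: "k < length w"
  show "w ! k \<le> \<delta> (q + k)"
  proof (cases "q = p \<or> q = r")
    case True then show ?thesis using assms k unfolding shifted_cliff_def by auto
  next
    case False
    then have "1 \<le> p + k" "p + k < q + k" "q + k < r + k" using assms by auto
    then have "\<not> (\<delta> (p + k) > \<delta> (q + k) \<and> \<delta> (q + k) < \<delta> (r + k))"
      using assms(1) unfolding unimodal_def by blast
    moreover have "w ! k \<le> \<delta> (p + k)" "w ! k \<le> \<delta> (r + k)" using assms k by (auto simp: shifted_cliff_def)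
    ultimately show ?thesis by auto
  qed
qed

theorem cliff_operad_ns_operad:
  assumes U: "unimodal \<delta>"
  shows "ns_operad (cliff_operad \<delta> :: ('k::field, _) operad_data)"
  unfolding cliff_operad_def
proof (rule ns_operad_linearized_operad, goal_cases)
  case (3 i s t r) then show ?case by (auto simp: cliff_size_def insert_word_def split: if_splits)
next
  case (6 i j s t u)
  define s1 s2 where "s1 = take (i - 1) s" and "s2 = drop (i - 1) s"
  have s: "s = s1 @ s2" and i: "i = length s1 + 1"
    using 6 by (auto simp: s1_def s2_def cliff_size_def)
  define t1 t2 where "t1 = take (j - 1) t" and "t2 = drop (j - 1) t"
  have t: "t = t1 @ t2" and j: "j = length t1 + 1"
    using 6 by (auto simp: t1_def t2_def cliff_size_def)
  have *: "insert_word i s t = s1 @ t1 @ t2 @ s2" "insert_word j t u = t1 @ u @ t2"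
     "insert_word (i + j - 1) (s1 @ t1 @ t2 @ s2) u = s1 @ t1 @ u @ t2 @ s2"
     "insert_word i s (t1 @ u @ t2) = s1 @ t1 @ u @ t2 @ s2"
    unfolding s t i j by (auto simp: insert_word_def)
  have "s1 @ t1 @ t2 @ s2 \<in> cliffs \<delta>" "t1 @ u @ t2 \<in> cliffs \<delta>" if "s1 @ t1 @ u @ t2 @ s2 \<in> cliffs \<delta>"
    using that 6(1-3) unfolding s t
    by (auto simp: cliffs_iff_shifted_cliff shifted_cliff_append
        intro: shifted_cliff_between[OF U, of "Suc (length t1)" t2 "Suc (length s1 + length t1 + length u)"]
          shifted_cliff_between[OF U, of "Suc (length s1)" s2 "Suc (length s1 + length t1 + length u + length t2)"]
          shifted_cliff_between[OF U, of "Suc 0" u "Suc (length s1 + length t1)"])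
  then show ?case by (auto simp: * simp del: One_nat_def)
next
  case (7 i j s t u)
  define s1 s2 s3 where "s1 = take (i - 1) s" and "s2 = drop (i - 1) (take (j - 1) s)" and "s3 = drop (j - 1) s"
  have s: "s = s1 @ s2 @ s3"
  proof -
    have "take (i - 1) (take (j - 1) s) = s1" using 7 by (simp add: s1_def min_def)
    then have "s1 @ s2 = take (j - 1) s" unfolding s2_def by (metis append_take_drop_id)
    then show ?thesis unfolding s3_def by (metis append_assoc append_take_drop_id)
  qed
  have i: "i = length s1 + 1" and j: "j = length s1 + length s2 + 1"
    using 7 by (auto simp: s1_def s2_def cliff_size_def)
  have *: "insert_word i s t = s1 @ t @ s2 @ s3" "insert_word j s u = s1 @ s2 @ u @ s3"
     "insert_word (j + cliff_size t - 1) (s1 @ t @ s2 @ s3) u = s1 @ t @ s2 @ u @ s3"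
     "insert_word i (s1 @ s2 @ u @ s3) t = s1 @ t @ s2 @ u @ s3"
    unfolding s i j by (auto simp: insert_word_def cliff_size_def)
  have "s1 @ t @ s2 @ s3 \<in> cliffs \<delta>" "s1 @ s2 @ u @ s3 \<in> cliffs \<delta>" if "s1 @ t @ s2 @ u @ s3 \<in> cliffs \<delta>"
    using that 7(1-3) unfolding s
    by (auto simp: cliffs_iff_shifted_cliff shifted_cliff_append
        intro: shifted_cliff_between[OF U, of "Suc (length s1 + length s2)" s3
              "Suc (length s1 + length t + length s2 + length u)"]
          shifted_cliff_between[OF U, of "Suc (length s1)" s2 "Suc (length s1 + length t)"]
          shifted_cliff_between[OF U, of "Suc 0" u "Suc (length s1 + length t + length s2)"])
  then show ?case by (auto simp: * simp del: One_nat_def)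
qed (auto simp: cliffs_def cliff_size_def insert_word_def)

lemma leaves_graft:
  "1 \<le> i \<Longrightarrow> i \<le> leaves s \<Longrightarrow> leaves (graft i s t) + 1 = leaves s + leaves t"
  "1 \<le> i \<Longrightarrow> i \<le> sum_list (map leaves ss) \<Longrightarrow> sum_list (map leaves (graft_list i ss t)) + 1 = sum_list (map leaves ss) + leaves t"
  by (induction i s t and i ss t rule: graft_graft_list.induct) auto

lemma length_graft_list [simp]: "length (graft_list i ss t) = length ss"
  by (induction ss arbitrary: i) auto

lemma syntax_tree_graft:
  "syntax_tree G s \<Longrightarrow> syntax_tree G t \<Longrightarrow> syntax_tree G (graft i s t)"
  "list_all (syntax_tree G) ss \<Longrightarrow> syntax_tree G t \<Longrightarrow> list_all (syntax_tree G) (graft_list i ss t)"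
  by (induction i s t and i ss t rule: graft_graft_list.induct) auto

lemma graft_Leaf:
  "t = Leaf \<Longrightarrow> graft i s t = s" "t = Leaf \<Longrightarrow> graft_list i ss t = ss"
  by (induction i s t and i ss t rule: graft_graft_list.induct) auto

lemma graft_seq:
  "1 \<le> i \<Longrightarrow> i \<le> leaves s \<Longrightarrow> 1 \<le> j \<Longrightarrow> j \<le> leaves t \<Longrightarrow> graft (i + j - 1) (graft i s t) u = graft i s (graft j t u)"
  "1 \<le> i \<Longrightarrow> i \<le> sum_list (map leaves ss) \<Longrightarrow> 1 \<le> j \<Longrightarrow> j \<le> leaves t \<Longrightarrow>
     graft_list (i + j - 1) (graft_list i ss t) u = graft_list i ss (graft j t u)"
proof (induction i s t and i ss t rule: graft_graft_list.induct)
  case (4 i s ss t)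
  then show ?case using leaves_graft(1)[of i s t] by auto
qed auto

lemma graft_par:
  "1 \<le> i \<Longrightarrow> i < j \<Longrightarrow> j \<le> leaves s \<Longrightarrow> graft (j + leaves t - 1) (graft i s t) u = graft i (graft j s u) t"
  "1 \<le> i \<Longrightarrow> i < j \<Longrightarrow> j \<le> sum_list (map leaves ss) \<Longrightarrow>
     graft_list (j + leaves t - 1) (graft_list i ss t) u = graft_list i (graft_list j ss u) t"
proof (induction i s t and i ss t arbitrary: j and j rule: graft_graft_list.induct)
  case (4 i s ss t j)
  consider "j \<le> leaves s" | "i \<le> leaves s" "leaves s < j" | "leaves s < i" by linarith
  then show ?case
  proof cases
    case 1 then show ?thesis using 4 leaves_graft(1)[of i s t] leaves_graft(1)[of j s u] by auto
  next
    case 2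
    then have "j + leaves t - 1 - leaves (graft i s t) = j - leaves s" "\<not> j + leaves t - 1 \<le> leaves (graft i s t)"
      using 4 leaves_graft(1)[of i s t] by auto
    then show ?thesis using 2 by auto
  next
    case 3
    have e: "j + leaves t - 1 - leaves s = (j - leaves s) + leaves t - 1" using 3 4(3-5) by linarith
    have "graft_list (j + leaves t - 1) (graft_list i (s # ss) t) u
      = s # graft_list (j + leaves t - 1 - leaves s) (graft_list (i - leaves s) ss t) u"
    proof -
      have "\<not> j + leaves t - 1 \<le> leaves s" using 3 4(3-5) by linarith
      then show ?thesis using 3 by simp
    qed
    also have "\<dots> = s # graft_list (i - leaves s) (graft_list (j - leaves s) ss u) t"
      unfolding e using 3 4(2)[of "j - leaves s"] 4(3-5) by simp
    also have "\<dots> = graft_list i (graft_list j (s # ss) u) t"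
      using 3 4(3-5) by simp
    finally show ?thesis .
  qed
qed auto

theorem free_operad_ns_operad: "ns_operad (free_operad G :: ('k::field, _) operad_data)"
  unfolding free_operad_def
proof (rule ns_operad_linearized_operad, goal_cases)
  case (3 i s t r) then show ?case using leaves_graft(1)[of i s t] by (auto intro: syntax_tree_graft)
next
  case (6 i j s t u) then show ?case using graft_seq(1)[of i s j t u] by simp
next
  case (7 i j s t u) then show ?case using graft_par(1)[of i j s t u] by simp
qed (auto simp: graft_Leaf)

context ns_operad begin

fun comp_from :: "'a \<Rightarrow> nat \<Rightarrow> 'a list \<Rightarrow> 'a" where
  "comp_from x p [] = x"
| "comp_from x p (y # ys) = pcomp P p (comp_from x (Suc p) ys) y"

lemma full_comp_comp_from: "full_comp P x ys = comp_from x 1 ys"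
proof -
  have "foldr (\<lambda>(i, y) z. pcomp P i z y) (zip [p..<p + length ys] ys) x = comp_from x p ys" for p
  proof (induction ys arbitrary: p)
    case (Cons y ys)
    have "[p..<p + length (y # ys)] = p # [Suc p..<Suc p + length ys]"
      by (simp add: upt_conv_Cons del: upt_Suc)
    then show ?case using Cons.IH[of "Suc p"] by (simp del: upt_Suc)
  qed simp
  from this[of 1] show ?thesis by (simp add: full_comp_def del: upt_Suc)
qed

lemma comp_from_closed:
  assumes "list_all2 (\<lambda>y n. y \<in> component P n) ys ns" "x \<in> component P m" "1 \<le> p" "p + length ys \<le> m + 1"
  shows "comp_from x p ys \<in> component P (m + sum_list ns - length ns)"
  using assms
proof (induction ys ns arbitrary: p rule: list_all2_induct)
  case (Cons y ys n ns)
  have len: "length ys = length ns" using Cons(2) by (rule list_all2_lengthD)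
  have "comp_from x (Suc p) ys \<in> component P (m + sum_list ns - length ns)"
    by (rule Cons.IH) (use Cons.prems in simp_all)
  from pcomp_closed[OF this Cons(1), of p]
  have "comp_from x p (y # ys) \<in> component P (m + sum_list ns - length ns + n - 1)"
    using Cons.prems len by simp
  moreover have "m + sum_list ns - length ns + n - 1 = m + sum_list (n # ns) - length (n # ns)"
    using Cons.prems len by simp
  ultimately show ?case by simp
qed auto

lemma comp_from_graft:
  assumes "list_all2 (\<lambda>t n. eval_tree P t \<in> component P n \<and> n = leaves t) ts ns" "x \<in> component P m" "1 \<le> p" "p + length ts \<le> m + 1"
   "\<And>s i. s \<in> set ts \<Longrightarrow> 1 \<le> i \<Longrightarrow> i \<le> leaves s \<Longrightarrow> eval_tree P (graft i s t) = pcomp P i (eval_tree P s) (eval_tree P t)"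
   "eval_tree P t \<in> component P n" "1 \<le> i" "i \<le> sum_list ns"
  shows "pcomp P (p + i - 1) (comp_from x p (map (eval_tree P) ts)) (eval_tree P t)
    = comp_from x p (map (eval_tree P) (graft_list i ts t))"
  using assms
proof (induction ts ns arbitrary: p i rule: list_all2_induct)
  case (Cons s ss k ks)
  have "length ss = length ks" using Cons(2) by (rule list_all2_lengthD)
  have l: "list_all2 (\<lambda>y n. y \<in> component P n) (map (eval_tree P) ss) ks"
    using Cons(2) by (auto simp: list_all2_conv_all_nth)
  from comp_from_closed[OF l, of x m "Suc p"] Cons.prems
  have X: "comp_from x (Suc p) (map (eval_tree P) ss) \<in> component P (m + sum_list ks - length ks)" by simp
  have k: "k = leaves s" "eval_tree P s \<in> component P k" using Cons(1) by blast+
  show ?case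
  proof (cases "i \<le> leaves s")
    case True
    then show ?thesis
      using sequential_assoc[OF X k(2) Cons.prems(5), of p i] Cons.prems k \<open>length ss = length ks\<close>
      by auto
  next
    case False
    have "pcomp P (Suc p + (i - leaves s) - 1) (comp_from x (Suc p) (map (eval_tree P) ss)) (eval_tree P t)
       = comp_from x (Suc p) (map (eval_tree P) (graft_list (i - leaves s) ss t))"
      by (rule Cons.IH) (use Cons.prems False k in auto)
    then show ?thesis
      using parallel_assoc[OF X k(2) Cons.prems(5), of p "p + i - k"] Cons.prems k False \<open>length ss = length ks\<close>
      by auto
  qed
qed auto

lemma eval_closed:
  assumes "\<And>n. G n \<subseteq> component P n"
  shows "syntax_tree G t \<Longrightarrow> eval_tree P t \<in> component P (leaves t)"
proof (induction t)
  case (Node g ts)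
  have l: "list_all2 (\<lambda>y n. y \<in> component P n) (map (eval_tree P) ts) (map leaves ts)"
    using Node by (auto simp: list_all2_conv_all_nth list_all_length)
  have "g \<in> component P (length ts)" using Node.prems assms[of "length ts"] by auto
  from comp_from_closed[OF l this, of 1] show ?case by (simp add: full_comp_comp_from)
qed (auto simp: unit_closed[simplified])

lemma eval_graft:
  assumes G: "\<And>n. G n \<subseteq> component P n" "syntax_tree G t"
  shows "syntax_tree G s \<Longrightarrow> 1 \<le> i \<Longrightarrow> i \<le> leaves s \<Longrightarrow>
     eval_tree P (graft i s t) = pcomp P i (eval_tree P s) (eval_tree P t)"
proof (induction s arbitrary: i)
  case Leaf then show ?case using unit_left[OF eval_closed[OF G]] by auto
next
  case (Node g ts)
  have l: "list_all2 (\<lambda>t n. eval_tree P t \<in> component P n \<and> n = leaves t) ts (map leaves ts)"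
    using Node eval_closed[OF G(1)] by (auto simp: list_all2_conv_all_nth list_all_length)
  have g: "g \<in> component P (length ts)" using Node.prems G(1)[of "length ts"] by auto
  have "pcomp P (1 + i - 1) (comp_from g 1 (map (eval_tree P) ts)) (eval_tree P t)
    = comp_from g 1 (map (eval_tree P) (graft_list i ts t))"
    by (rule comp_from_graft[OF l g _ _ _ eval_closed[OF G]]) (use Node in \<open>auto simp: list_all_iff\<close>)
  then show ?case by (simp add: full_comp_comp_from)
qed

lemma eval_tree_corolla:
  assumes "g \<in> component P n" shows "eval_tree P (Node g (replicate n Leaf)) = g"
proof -
  have "comp_from g p (replicate k (op_unit P)) = g" if "1 \<le> p" "p + k \<le> n + 1" for p k
    using that by (induction k arbitrary: p) (auto simp: unit_right[OF assms])
  from this[of 1 n] show ?thesis by (simp add: full_comp_comp_from)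
qed

theorem canonical_morphism_pcomp:
  assumes G: "\<And>n. G n \<subseteq> component P n"
  and f: "f \<in> component (free_operad G) m" and g: "g \<in> component (free_operad G) n" and i: "1 \<le> i" "i \<le> m"
  shows "canonical_morphism P f \<in> component P m"
    "canonical_morphism P (pcomp (free_operad G) i f g)
      = pcomp P i (canonical_morphism P f) (canonical_morphism P g)"
proof -
  interpret V: vector_space "scale P" by (rule vector_space_scale)
  note L = linear_ext_add[OF vector_space_scale] linear_ext_single[OF vector_space_scale] canonical_morphism_def
  have pc: "pcomp (free_operad G) i = bilinear_ext (\<lambda>s t. Some (graft i s t))"
    unfolding free_operad_def linearized_operad_def by (auto simp: bilinear_ext_def fun_eq_iff)
  have cl: "canonical_morphism P f \<in> component P m" if "f \<in> component (free_operad G) m" for f m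
  proof -
    have "Poly_Mapping.keys f \<subseteq> {t. syntax_tree G t \<and> leaves t = m}"
      using that unfolding free_operad_def linearized_operad_def by auto
    then show ?thesis
    proof (induction f rule: pm_component_induct)
      case 1 show ?case using V.subspace_0[OF component_subspace] by (simp add: canonical_morphism_def)
    next
      case (2 t c)
      then have "eval_tree P t \<in> component P m" using eval_closed[OF G(1), of t] by auto
      then show ?case unfolding L by (rule V.subspace_scale[OF component_subspace])
    next
      case (3 f g) then show ?case unfolding L by (intro V.subspace_add[OF component_subspace])
    qed
  qed
  show "canonical_morphism P f \<in> component P m" by (rule cl[OF f])
  have comp: "h \<in> component (free_operad G) k" if "Poly_Mapping.keys h \<subseteq> {t. syntax_tree G t \<and> leaves t = k}" for h k
    using that unfolding free_operad_def linearized_operad_def by auto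
  have kf: "Poly_Mapping.keys f \<subseteq> {t. syntax_tree G t \<and> leaves t = m}"
   and kg: "Poly_Mapping.keys g \<subseteq> {t. syntax_tree G t \<and> leaves t = n}"
    using f g unfolding free_operad_def linearized_operad_def by auto
  have z: "pcomp P i 0 y = 0" if "y \<in> component P n" for y
    using pcomp_scale_left[of 0 m y n i 0] that i V.subspace_0[OF component_subspace] by simp
  have z': "pcomp P i x 0 = 0" if "x \<in> component P m" for x
    using pcomp_scale_right[of x m 0 n i 0] that i V.subspace_0[OF component_subspace] by simp
  from kf show "canonical_morphism P (pcomp (free_operad G) i f g) = pcomp P i (canonical_morphism P f) (canonical_morphism P g)"
    unfolding pc
  proof (induction f rule: pm_component_induct)
    case 1 show ?case using z[OF cl[OF g]] by (simp add: canonical_morphism_def)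
  next
    case (3 f f')
    then show ?case using pcomp_add_left[OF cl[OF comp] cl[OF comp] cl[OF g] i] by (simp add: bilinear_ext_add_left L)
  next
    case (2 s c)
    have s: "canonical_morphism P (Poly_Mapping.single s c) \<in> component P m" by (rule cl, rule comp) (use 2 in auto)
    from kg show ?case
    proof (induction g rule: pm_component_induct)
      case 1 show ?case using z'[OF s] by (simp add: canonical_morphism_def)
    next
      case (3 f f')
      then show ?case using pcomp_add_right[OF s cl[OF comp] cl[OF comp] i] by (simp add: bilinear_ext_add_right L)
    next
      case (2 t d)
      have st: "eval_tree P s \<in> component P m" "eval_tree P t \<in> component P n"
        using eval_closed[OF G(1), of s] eval_closed[OF G(1), of t] 2 \<open>s \<in> _\<close> by auto
      have ds: "scale P d (eval_tree P t) \<in> component P n"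
        by (rule V.subspace_scale[OF component_subspace st(2)])
      have "eval_tree P (graft i s t) = pcomp P i (eval_tree P s) (eval_tree P t)"
        by (rule eval_graft[where G=G]) (use G 2 \<open>s \<in> _\<close> i in auto)
      then show ?case
        by (simp add: bilinear_ext_single L pcomp_scale_left[OF st(1) ds i] pcomp_scale_right[OF st i])
    qed
  qed
qed

theorem canonical_morphism_unit: "canonical_morphism P (op_unit (free_operad G)) = op_unit P"
proof -
  interpret V: vector_space "scale P" by (rule vector_space_scale)
  show ?thesis
    by (simp add: canonical_morphism_def free_operad_def linearized_operad_def
        linear_ext_single[OF vector_space_scale])
qed

theorem canonical_morphism_generator:
  assumes "g \<in> component P n"
  shows "canonical_morphism P (Poly_Mapping.single (Node g (replicate n Leaf)) 1) = g"
proof -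
  interpret V: vector_space "scale P" by (rule vector_space_scale)
  show ?thesis
    by (simp only: canonical_morphism_def linear_ext_single[OF vector_space_scale]
        eval_tree_corolla[OF assms] V.scale_one)
qed

end

lemma cliff_generators_subset: "cliff_generators \<delta> n \<subseteq> component (cliff_operad \<delta>) n"
  by (auto simp: cliff_generators_def cliff_operad_def linearized_operad_def prime_cliff_def)

end

(*
  Over a minimal generating set, every tree occurring in a relation has at least two nodes.  Hence
  the elements of the free operad supported on trees with at least two nodes and avoiding a fixed
  two-node tree t form an ideal: grafting anything but a leaf onto a tree with two nodes produces
  at least three.  So a relation in which a two-node tree occurs does not follow from relations of
  other arities, and it suffices to find such relations in arbitrarily large arity.

  If delta is not 1-dominated, let m be the first position where delta exceeds d = delta(1); by
  unimodality delta exceeds d from m on, and m >= 2.  Then all words p = 0^(m-1) (d+1)^k with k >= 1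
  are prime, and inserting the letter 0 in p at position 1 or at position 2 gives the same word.
*)

theory Submission
  imports Defs
begin

section \<open>Supports of linear extensions\<close>

lemma keys_pm_scale: "Poly_Mapping.keys (pm_scale c f) \<subseteq> Poly_Mapping.keys f"
  by (auto simp: in_keys_iff)

lemma lookup_linear_ext:
  "Poly_Mapping.lookup (linear_ext pm_scale h f) r =
    (\<Sum>t\<in>Poly_Mapping.keys f. Poly_Mapping.lookup f t * Poly_Mapping.lookup (h t) r)"
  by (simp add: linear_ext_def lookup_sum)

lemma keys_linear_ext:
  "Poly_Mapping.keys (linear_ext pm_scale h f) \<subseteq> (\<Union>t\<in>Poly_Mapping.keys f. Poly_Mapping.keys (h t))"
proof
  fix r assume "r \<in> Poly_Mapping.keys (linear_ext pm_scale h f)"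
  then have "(\<Sum>t\<in>Poly_Mapping.keys f. Poly_Mapping.lookup f t * Poly_Mapping.lookup (h t) r) \<noteq> 0"
    by (simp add: in_keys_iff lookup_linear_ext)
  then obtain t where "t \<in> Poly_Mapping.keys f" "Poly_Mapping.lookup f t * Poly_Mapping.lookup (h t) r \<noteq> 0"
    by (rule sum.not_neutral_contains_not_neutral)
  then show "r \<in> (\<Union>t\<in>Poly_Mapping.keys f. Poly_Mapping.keys (h t))"
    by (auto simp: in_keys_iff)
qed

text \<open>Terms may cancel, so this only bounds the support from above; that is all an argument
  about supports lying in a given set of trees or words requires.\<close>

lemma keys_bilinear_ext:
  fixes f g :: "'b \<Rightarrow>\<^sub>0 'k::field"
  assumes "r \<in> Poly_Mapping.keys (bilinear_ext b f g)"
  obtains s t where "s \<in> Poly_Mapping.keys f" "t \<in> Poly_Mapping.keys g" "b s t = Some r"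
proof -
  obtain s where s: "s \<in> Poly_Mapping.keys f"
    and "r \<in> Poly_Mapping.keys (linear_ext pm_scale (\<lambda>t.
      case b s t of None \<Rightarrow> 0 | Some r \<Rightarrow> Poly_Mapping.single r 1) g)"
    using assms keys_linear_ext unfolding bilinear_ext_def by fast
  then obtain t where "t \<in> Poly_Mapping.keys g"
    and "r \<in> Poly_Mapping.keys (case b s t of None \<Rightarrow> 0 | Some r \<Rightarrow> Poly_Mapping.single r (1::'k))"
    using keys_linear_ext by fast
  with s that show thesis by (auto split: option.splits if_splits)
qed

section \<open>Counting internal nodes\<close>

text \<open>The degree of a tree in the free operad: it counts generators, so leaves contribute
  nothing and grafting is additive.\<close>

primrec nodes :: "'g stree \<Rightarrow> nat" where
  "nodes Leaf = 0"
| "nodes (Node g ts) = Suc (sum_list (map nodes ts))"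

lemma nodes_eq_0_iff [simp]: "nodes t = 0 \<longleftrightarrow> t = Leaf"
  by (cases t) auto

text \<open>The bounds on \<open>i\<close> matter: past the last leaf, \<open>graft_list\<close>
  runs to the end of the list and drops \<open>t\<close>.\<close>

lemma nodes_graft:
  "1 \<le> i \<Longrightarrow> i \<le> leaves s \<Longrightarrow> nodes (graft i s t) = nodes s + nodes t"
  "1 \<le> i \<Longrightarrow> i \<le> sum_list (map leaves ss) \<Longrightarrow>
    sum_list (map nodes (graft_list i ss t)) = sum_list (map nodes ss) + nodes t"
  by (induction i s t and i ss t rule: graft_graft_list.induct) auto

lemma nodes_le_1_cases:
  assumes "nodes t \<le> 1"
  obtains "t = Leaf" | g n where "t = Node g (replicate n Leaf)"
proof (cases t)
  case (Node g ts)
  then have "\<forall>s\<in>set ts. s = Leaf" using assms by auto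
  then have "ts = replicate (length ts) Leaf"
    by (metis replicate_length_same)
  with Node that(2) show thesis by blast
qed (use that in auto)

lemma graft_list_append_Leaf:
  "graft_list (Suc (sum_list (map leaves as))) (as @ Leaf # bs) t = as @ t # bs"
  by (induction as) auto

text \<open>Cut the edge between the root and a child that is not a leaf. Such a child exists, since
  otherwise the root would be the only node.\<close>

lemma nodes_ge_2_graft:
  assumes "syntax_tree G t" "2 \<le> nodes t"
  obtains i s u where "t = graft i s u" "1 \<le> i" "i \<le> leaves s" "syntax_tree G s" "syntax_tree G u"
    "s \<noteq> Leaf" "u \<noteq> Leaf"
proof -
  obtain g ts where t: "t = Node g ts" using assms(2) by (cases t) auto
  have "\<exists>u\<in>set ts. u \<noteq> Leaf"
  proof (rule ccontr)
    assume "\<not> ?thesis"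
    then have "sum_list (map nodes ts) = 0" by simp
    with assms(2) t show False by simp
  qed
  then obtain as u bs where ts: "ts = as @ u # bs" and u: "u \<noteq> Leaf"
    by (metis split_list)
  show thesis
  proof
    show "t = graft (Suc (sum_list (map leaves as))) (Node g (as @ Leaf # bs)) u"
      by (simp add: t ts graft_list_append_Leaf)
  qed (use assms(1) u in \<open>auto simp: t ts\<close>)
qed

text \<open>Without generators of arity 0 or 1, the root has at least two children, and inductively
  each of them has a leaf.\<close>

lemma syntax_tree_leaves:
  assumes "G 0 = {}" "G 1 = {}" "syntax_tree G t"
  shows "1 \<le> leaves t \<and> (t \<noteq> Leaf \<longrightarrow> 2 \<le> leaves t)"
  using assms(3)
proof (induction t)
  case (Node g ts)
  have "length ts \<noteq> 0" "length ts \<noteq> 1" using Node.prems assms(1,2) by (metis empty_iff syntax_tree.simps(2))+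
  moreover have "length ts \<le> sum_list (map leaves ts)"
  proof -
    have "1 \<le> leaves s" if "s \<in> set ts" for s
      using Node that by (auto simp: list_all_iff)
    then have "sum_list (map (\<lambda>_. 1) ts) \<le> sum_list (map leaves ts)"
      by (rule sum_list_mono)
    then show ?thesis by (simp add: sum_list_triv)
  qed
  ultimately have "2 \<le> sum_list (map leaves ts)" by linarith
  then show ?case by simp
qed simp

section \<open>A criterion for infinitely many relations\<close>

lemma component_free_operad:
  "component (free_operad G) n = {f. \<forall>t\<in>Poly_Mapping.keys f. syntax_tree G t \<and> leaves t = n}"
  by (simp add: free_operad_def linearized_operad_def)

lemma pcomp_free_operad:
  "pcomp (free_operad G) i = bilinear_ext (\<lambda>s t. Some (graft i s t))"
  by (simp add: free_operad_def linearized_operad_def)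

lemma scale_free_operad: "scale (free_operad G) = pm_scale"
  by (simp add: free_operad_def linearized_operad_def)

text \<open>This ideal separates a relation containing \<open>t0\<close> from all relations that
  avoid it. The bound of two nodes on every tree is what keeps \<open>t0\<close> out of reach:
  composing two one-node trees could produce it.\<close>

lemma operad_ideal_avoiding_tree:
  assumes "nodes t0 = 2"
  shows "operad_ideal (free_operad G :: ('k::field, _) operad_data)
    (\<lambda>n. {f \<in> component (free_operad G) n. \<forall>t\<in>Poly_Mapping.keys f. 2 \<le> nodes t \<and> t \<noteq> t0})"
    (is "operad_ideal ?F ?I")
proof -
  interpret ns_operad ?F by (rule free_operad_ns_operad)
  interpret V: vector_space "pm_scale :: 'k \<Rightarrow> ('a stree \<Rightarrow>\<^sub>0 'k) \<Rightarrow> _" by (rule vector_space_pm_scale)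
  have subspace: "V.subspace (?I n)" for n
  proof (rule V.subspaceI)
    show "0 \<in> ?I n" by (simp add: component_free_operad)
  next
    fix f g assume "f \<in> ?I n" "g \<in> ?I n"
    then show "f + g \<in> ?I n" using keys_add[of f g] by (auto simp: component_free_operad)
  next
    fix c f assume "f \<in> ?I n"
    then show "pm_scale c f \<in> ?I n" using keys_pm_scale[of c f] by (auto simp: component_free_operad)
  qed
  have closed: "pcomp ?F i x y \<in> ?I (m + n - 1)"
    if x: "x \<in> component ?F m" and y: "y \<in> component ?F n" and i: "1 \<le> i" "i \<le> m"
      and xy: "x \<in> ?I m \<or> y \<in> ?I n" for m n i x y
  proof -
    have "2 \<le> nodes r \<and> r \<noteq> t0" if r: "r \<in> Poly_Mapping.keys (pcomp ?F i x y)" for r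
    proof -
      obtain s t where s: "s \<in> Poly_Mapping.keys x" and t: "t \<in> Poly_Mapping.keys y"
        and rst: "graft i s t = r"
        using r unfolding pcomp_free_operad by (auto elim: keys_bilinear_ext)
      have ls: "leaves s = m" using x s by (simp add: component_free_operad)
      have st: "2 \<le> nodes s \<and> s \<noteq> t0 \<or> 2 \<le> nodes t \<and> t \<noteq> t0" using xy s t by auto
      have nr: "nodes r = nodes s + nodes t" using nodes_graft(1)[of i s t] i ls rst by simp
      \<comment> \<open>If one factor is a leaf, the graft equals the other factor, which must be
        the one controlled by \<open>st\<close>. Otherwise node counts add up to at least
        three.\<close>
      consider "s = Leaf" | "t = Leaf" | "nodes s \<noteq> 0" "nodes t \<noteq> 0" by auto
      then show ?thesis
      proof cases
        case 3
        then have "3 \<le> nodes r" using st nr by linarith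
        then show ?thesis using assms by auto
      qed (use st rst in \<open>auto simp: graft_Leaf(1)\<close>)
    qed
    then show ?thesis using pcomp_closed[OF x y i] by simp
  qed
  show ?thesis
    unfolding operad_ideal_def scale_free_operad
  proof (intro conjI allI ballI impI; (elim conjE)?)
    fix n
    show "?I n \<subseteq> component ?F n" by (rule Collect_restrict)
    show "V.subspace (?I n)" by (rule subspace)
  next
    fix m n i x y
    assume "x \<in> component ?F m" "y \<in> component ?F n" "1 \<le> i" "i \<le> m" "x \<in> ?I m \<or> y \<in> ?I n"
    then show "pcomp ?F i x y \<in> ?I (m + n - 1)" by (rule closed)
  qed
qed

text \<open>A finite set of relations involves only trees of bounded arity. A two-node tree of
  larger arity occurs in none of them, so they all lie in the ideal avoiding this tree, while some
  relation does not.\<close>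

lemma not_finitely_generated_idealI:
  fixes R :: "nat \<Rightarrow> ('g stree \<Rightarrow>\<^sub>0 'k::field) set"
  assumes minimal: "\<And>n f t. f \<in> R n \<Longrightarrow> t \<in> Poly_Mapping.keys f \<Longrightarrow> 2 \<le> nodes t"
    and quadratic: "\<And>N. \<exists>n\<ge>N. \<exists>f\<in>R n \<inter> component (free_operad G) n. \<exists>t\<in>Poly_Mapping.keys f. nodes t = 2"
  shows "\<not> finitely_generated_ideal (free_operad G) R"
proof
  let ?F = "free_operad G :: ('k, 'g stree \<Rightarrow>\<^sub>0 'k) operad_data"
  assume "finitely_generated_ideal ?F R"
  then obtain X where X: "finite X" "X \<subseteq> (\<Union>n. component ?F n)" "R = generated_ideal ?F X"
    unfolding finitely_generated_ideal_def by auto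
  \<comment> \<open>Bounding the arities of the trees that occur, not of the elements of
    \<open>X\<close>, is unambiguous even for zero, which lies in every component.\<close>
  have "finite (\<Union>f\<in>X. leaves ` Poly_Mapping.keys f)" using X(1) by simp
  then obtain N where N: "\<And>f t. f \<in> X \<Longrightarrow> t \<in> Poly_Mapping.keys f \<Longrightarrow> leaves t < N"
    unfolding finite_nat_set_iff_bounded by blast
  obtain n f t0 where n: "N \<le> n" and f: "f \<in> R n" "f \<in> component ?F n"
    and t0: "t0 \<in> Poly_Mapping.keys f" "nodes t0 = 2"
    using quadratic[of N] by blast
  have "leaves t0 = n" using f(2) t0(1) by (simp add: component_free_operad)
  define I where "I = (\<lambda>n. {f \<in> component ?F n. \<forall>t\<in>Poly_Mapping.keys f. 2 \<le> nodes t \<and> t \<noteq> t0})"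
  have "X \<inter> component ?F m \<subseteq> I m" for m
  proof
    fix x assume x: "x \<in> X \<inter> component ?F m"
    then have "x \<in> R m" unfolding X(3) generated_ideal_def by auto
    moreover have "leaves t < N" if "t \<in> Poly_Mapping.keys x" for t
      using N that x by blast
    ultimately have "2 \<le> nodes t \<and> t \<noteq> t0" if "t \<in> Poly_Mapping.keys x" for t
      using minimal that n \<open>leaves t0 = n\<close> by (metis not_le)
    then show "x \<in> I m" using x by (simp add: I_def)
  qed
  moreover have "operad_ideal ?F I"
    unfolding I_def by (rule operad_ideal_avoiding_tree[OF t0(2)])
  ultimately have "R n \<subseteq> I n" unfolding X(3) generated_ideal_def by auto
  with f(1) t0(1) show False by (auto simp: I_def)
qed

section \<open>Minimality of the presentation\<close>

lemma component_cliff_operad: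
  "component (cliff_operad \<delta>) n = {f. \<forall>w\<in>Poly_Mapping.keys f. w \<in> cliffs \<delta> \<and> cliff_size w = n}"
  by (simp add: cliff_operad_def linearized_operad_def)

lemma pcomp_cliff_operad:
  "pcomp (cliff_operad \<delta>) i = bilinear_ext
    (\<lambda>u v. if insert_word i u v \<in> cliffs \<delta> then Some (insert_word i u v) else None)"
  by (simp add: cliff_operad_def linearized_operad_def)

lemma scale_cliff_operad: "scale (cliff_operad \<delta>) = pm_scale"
  by (simp add: cliff_operad_def linearized_operad_def)

lemma cliff_generators_0_1: "cliff_generators \<delta> 0 = {}" "cliff_generators \<delta> 1 = {}"
  by (auto simp: cliff_generators_def cliff_size_def prime_cliff_def)

lemma syntax_tree_cliff_corolla:
  "syntax_tree (cliff_generators \<delta>) (Node (g :: _ \<Rightarrow>\<^sub>0 'k::field) (replicate n Leaf)) \<longleftrightarrow>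
    (\<exists>w. prime_cliff \<delta> w \<and> n = cliff_size w \<and> g = Poly_Mapping.single w 1)"
  by (auto simp: cliff_generators_def list_all_iff)

lemma eval_tree_cliff_corolla:
  assumes "unimodal \<delta>" "prime_cliff \<delta> w"
  shows "eval_tree (cliff_operad \<delta>)
      (Node (Poly_Mapping.single w (1::'k::field)) (replicate (cliff_size w) Leaf))
    = Poly_Mapping.single w 1"
  by (rule ns_operad.eval_tree_corolla[OF cliff_operad_ns_operad[OF assms(1)]])
    (use assms(2) in \<open>auto simp: component_cliff_operad prime_cliff_def\<close>)

text \<open>Cut \<open>t\<close> into two trees other than a leaf. Their values are supported on
  nonempty cliffs, so \<open>w\<close> arises by a nontrivial insertion.\<close>

lemma eval_tree_cliff_decomposable:
  assumes U: "unimodal \<delta>" and t: "syntax_tree (cliff_generators \<delta>) t" "2 \<le> nodes t"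
    and w: "w \<in> Poly_Mapping.keys (eval_tree (cliff_operad \<delta>) t :: _ \<Rightarrow>\<^sub>0 'k::field)"
  shows "w \<noteq> [] \<and> \<not> prime_cliff \<delta> w"
proof -
  interpret ns_operad "cliff_operad \<delta> :: ('k, _) operad_data" by (rule cliff_operad_ns_operad[OF U])
  note closed = eval_closed[of "cliff_generators \<delta>", OF cliff_generators_subset]
  obtain i s u where tsu: "t = graft i s u" "1 \<le> i" "i \<le> leaves s" "s \<noteq> Leaf" "u \<noteq> Leaf"
    and s: "syntax_tree (cliff_generators \<delta>) s" and u: "syntax_tree (cliff_generators \<delta>) u"
    using nodes_ge_2_graft[OF t] by metis
  have "eval_tree (cliff_operad \<delta>) t
      = pcomp (cliff_operad \<delta>) i (eval_tree (cliff_operad \<delta>) s) (eval_tree (cliff_operad \<delta>) u)"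
    unfolding tsu(1) by (rule eval_graft[OF cliff_generators_subset u s tsu(2,3)])
  with w obtain x y where x: "x \<in> Poly_Mapping.keys (eval_tree (cliff_operad \<delta>) s)"
    and y: "y \<in> Poly_Mapping.keys (eval_tree (cliff_operad \<delta>) u)"
    and wxy: "w = insert_word i x y"
    by (auto simp: pcomp_cliff_operad elim!: keys_bilinear_ext split: if_splits)
  have "x \<in> cliffs \<delta>" "cliff_size x = leaves s" "y \<in> cliffs \<delta>" "cliff_size y = leaves u"
    using closed[OF s] closed[OF u] x y by (auto simp: component_cliff_operad)
  \<comment> \<open>Arity is length plus one, so two leaves on each side make both words
    nonempty.\<close>
  moreover have "2 \<le> leaves s" "2 \<le> leaves u"
    using syntax_tree_leaves[of "cliff_generators \<delta>"] cliff_generators_0_1 s u tsu(4,5) by blast+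
  moreover from calculation have "x \<noteq> []" "y \<noteq> []" by (auto simp: cliff_size_def)
  moreover have "(x, y) \<in> {(w, []), ([], w)}" if "prime_cliff \<delta> w"
    using that calculation wxy tsu(2,3) unfolding prime_cliff_def by metis
  ultimately have "\<not> prime_cliff \<delta> w" by blast
  with \<open>y \<noteq> []\<close> show ?thesis using wxy by (simp add: insert_word_def)
qed

text \<open>Trees with at most one node evaluate to distinct basis elements, indexed by the empty
  word or a prime cliff, and larger trees never contribute to these words. If \<open>t\<close> were
  such a tree with word \<open>w\<close>, the coefficient of \<open>w\<close> in the image of
  \<open>f\<close> would be that of \<open>t\<close> in \<open>f\<close>, hence nonzero.\<close>

lemma nontrivial_relations_nodes:
  fixes f :: "(nat list \<Rightarrow>\<^sub>0 'k::field) stree \<Rightarrow>\<^sub>0 'k"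
  assumes U: "unimodal \<delta>" and f: "f \<in> nontrivial_relations \<delta> n" and t: "t \<in> Poly_Mapping.keys f"
  shows "2 \<le> nodes t"
proof (rule ccontr)
  assume "\<not> 2 \<le> nodes t"
  then have nt: "nodes t \<le> 1" by simp
  let ?ev = "eval_tree (cliff_operad \<delta>) :: _ \<Rightarrow> nat list \<Rightarrow>\<^sub>0 'k"
  let ?word = "\<lambda>s :: (nat list \<Rightarrow>\<^sub>0 'k) stree. \<lambda>w. s = Leaf \<and> w = [] \<or>
    prime_cliff \<delta> w \<and> s = Node (Poly_Mapping.single w 1) (replicate (cliff_size w) Leaf)"
  have syn: "syntax_tree (cliff_generators \<delta>) s" if "s \<in> Poly_Mapping.keys f" for s
    using f that by (simp add: nontrivial_relations_def relations_def component_free_operad)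
  have small: "\<exists>w. ?word s w" if "syntax_tree (cliff_generators \<delta>) s" "nodes s \<le> 1" for s
    using that(2)
  proof (cases s rule: nodes_le_1_cases)
    case (2 g n)
    with that(1) show ?thesis unfolding 2 syntax_tree_cliff_corolla by blast
  qed blast
  have ev: "?ev s = Poly_Mapping.single w 1" if "?word s w" for s w
    using that
  proof
    assume "s = Leaf \<and> w = []"
    then show ?thesis by (simp add: cliff_operad_def linearized_operad_def)
  qed (use eval_tree_cliff_corolla[OF U] in blast)
  obtain w where w: "?word t w" using small[OF syn[OF t] nt] by blast
  have "Poly_Mapping.lookup (?ev s) w = (if s = t then 1 else 0)" if s: "s \<in> Poly_Mapping.keys f" for s
  proof (cases "nodes s \<le> 1")
    case True
    then obtain w' where w': "?word s w'" using small[OF syn[OF s]] by blast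
    \<comment> \<open>A tree has only one value, which determines the word; conversely, prime cliffs
      are nonempty, so a leaf and a corolla never share a word.\<close>
    have "w = w' \<longleftrightarrow> s = t"
    proof
      assume "s = t"
      then have "Poly_Mapping.single w (1::'k) = Poly_Mapping.single w' 1" using ev w w' by metis
      then show "w = w'" by (metis lookup_single_eq lookup_single_not_eq zero_neq_one)
    qed (use w w' in \<open>auto simp: prime_cliff_def\<close>)
    then show ?thesis using ev[OF w'] by (auto simp: lookup_single when_def)
  next
    case False
    then have "w \<notin> Poly_Mapping.keys (?ev s)"
      using eval_tree_cliff_decomposable[OF U syn[OF s], of w] w by auto
    moreover have "s \<noteq> t" using False nt by auto
    ultimately show ?thesis by (simp add: in_keys_iff)
  qed
  then have "Poly_Mapping.lookup (canonical_morphism (cliff_operad \<delta>) f) w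
      = (\<Sum>s\<in>Poly_Mapping.keys f. Poly_Mapping.lookup f s * (if s = t then 1 else 0))"
    unfolding canonical_morphism_def scale_cliff_operad lookup_linear_ext by (simp cong: sum.cong)
  also have "\<dots> = Poly_Mapping.lookup f t" using t by (simp add: sum.delta if_distrib cong: if_cong)
  finally show False
    using f t by (simp add: nontrivial_relations_def relations_def in_keys_iff)
qed

section \<open>Prime cliffs of unbounded size\<close>

text \<open>Take the least position where \<delta> exceeds its first value; it cannot be 1. A later
  return to that value or below would create a valley.\<close>

lemma first_exceeding_position:
  assumes "unimodal \<delta>" "\<not> one_dominated \<delta>"
  obtains m where "2 \<le> m" "\<And>i. 1 \<le> i \<Longrightarrow> i < m \<Longrightarrow> \<delta> i \<le> \<delta> 1" "\<And>i. m \<le> i \<Longrightarrow> \<delta> 1 < \<delta> i"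
proof -
  have ex: "\<exists>k'\<ge>k. \<delta> 1 < \<delta> k'" if "1 \<le> k" for k
    using assms(2) that unfolding one_dominated_def by (meson not_le)
  define m where "m = (LEAST i. 1 \<le> i \<and> \<delta> 1 < \<delta> i)"
  have m: "1 \<le> m \<and> \<delta> 1 < \<delta> m"
    unfolding m_def by (rule LeastI_ex) (use ex[of 1] in auto)
  have "\<delta> i \<le> \<delta> 1" if "1 \<le> i" "i < m" for i
    using not_less_Least[of i "\<lambda>i. 1 \<le> i \<and> \<delta> 1 < \<delta> i"] that unfolding m_def by auto
  moreover have "\<delta> 1 < \<delta> i" if "m \<le> i" for i
  proof (rule ccontr)
    assume "\<not> \<delta> 1 < \<delta> i"
    then have le: "\<delta> i \<le> \<delta> 1" by simp
    have "m < i" using m that le by (cases "i = m") auto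
    have "1 \<le> i" using m that by linarith
    \<comment> \<open>Failure of domination gives a high position beyond \<open>i\<close>, so
      \<open>i\<close> is a valley between \<open>m\<close> and \<open>j\<close>.\<close>
    then obtain j where j: "i \<le> j" "\<delta> 1 < \<delta> j" using ex by blast
    then have "i < j" using le by (cases "i = j") auto
    moreover have "\<delta> i < \<delta> m" "\<delta> i < \<delta> j" using m j le by linarith+
    ultimately show False using assms(1) m \<open>m < i\<close> unfolding unimodal_def by blast
  qed
  moreover have "2 \<le> m" using m by (cases "m = 1") auto
  ultimately show thesis using that by blast
qed

text \<open>The letter \<open>Suc (\<delta> 1)\<close> is admissible in a cliff only from position
  \<open>m\<close> on, and here it first occurs exactly there. Any nontrivial splitting moves some
  copy of it further left in one of the factors.\<close>

lemma prime_cliff_replicate: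
  assumes m: "2 \<le> m" "\<And>i. 1 \<le> i \<Longrightarrow> i < m \<Longrightarrow> \<delta> i \<le> \<delta> 1" "\<And>i. m \<le> i \<Longrightarrow> \<delta> 1 < \<delta> i" and k: "1 \<le> k"
  shows "prime_cliff \<delta> (replicate (m - 1) 0 @ replicate k (Suc (\<delta> 1)))" (is "prime_cliff \<delta> ?w")
proof -
  have cl: "?w \<in> cliffs \<delta>" using m(1,3) by (auto simp: cliffs_def nth_append Suc_le_eq)
  have low: "m \<le> Suc j" if "x \<in> cliffs \<delta>" "j < length x" "x ! j = Suc (\<delta> 1)" for x j
  proof (rule ccontr)
    assume "\<not> m \<le> Suc j"
    then have "\<delta> (Suc j) \<le> \<delta> 1" using m(2)[of "Suc j"] by simp
    moreover have "x ! j \<le> \<delta> (Suc j)"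
      using that(1,2) unfolding cliffs_def by (auto dest!: spec[of _ "Suc j"])
    ultimately show False using that(3) by simp
  qed
  have high: "?w ! j = Suc (\<delta> 1)" if "m - 1 \<le> j" "j < length ?w" for j
    using that by (auto simp: nth_append)
  have False if uv: "u \<in> cliffs \<delta>" "v \<in> cliffs \<delta>" "1 \<le> i" "i \<le> cliff_size u"
      "?w = insert_word i u v" "u \<noteq> []" "v \<noteq> []" for u v i
  proof -
    obtain a where i: "i = Suc a" using uv(3) by (cases i) auto
    have a: "a \<le> length u" using uv(4) by (simp add: i cliff_size_def)
    have len: "length ?w = length u + length v"
      unfolding uv(5) using a by (simp add: insert_word_def i)
    have v: "?w ! (a + j) = v ! j" if "j < length v" for j
      unfolding uv(5) using a that by (simp add: insert_word_def i nth_append)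
    have u: "?w ! (length v + j) = u ! j" if "a \<le> j" "j < length u" for j
      unfolding uv(5) using a that by (auto simp: insert_word_def i nth_append)
    have pos: "length u > 0" "length v > 0" using uv by auto
    have lw: "m - 1 < length ?w" using k by simp
    \<comment> \<open>The cases locate the inserted block relative to index \<open>m - 1\<close>,
      the zero-based index of the first high letter: the block ends before it, reaches it without
      being a prefix, or reaches it as a prefix. The offending letter then lies in \<open>u\<close>,
      in \<open>v\<close>, or at the start of \<open>u\<close>.\<close>
    consider "a + length v \<le> m - 1" | "0 < a" "m - 1 < a + length v" | "a = 0" "m - 1 < length v"
      by linarith
    then show False
    proof cases
      case 1
      have j: "a \<le> m - 1 - length v" "m - 1 - length v < length u"
        "length v + (m - 1 - length v) = m - 1"
        using 1 lw len by linarith+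
      have "u ! (m - 1 - length v) = Suc (\<delta> 1)"
        using u[OF j(1,2)] high[OF le_refl lw] unfolding j(3) by simp
      from low[OF uv(1) _ this] 1 pos lw len m(1) show False by linarith
    next
      case 2
      \<comment> \<open>Truncated subtraction also covers a block starting beyond the first high
        letter: the index is then 0, and \<open>v\<close> itself starts with a high letter.\<close>
      have j: "m - 1 - a < length v" "m - 1 \<le> a + (m - 1 - a)" "a + (m - 1 - a) < length ?w"
        using 2 lw len a pos by linarith+
      have "v ! (m - 1 - a) = Suc (\<delta> 1)"
        using trans[OF v[OF j(1), symmetric] high[OF j(2,3)]] .
      from low[OF uv(2) j(1) this] 2 pos m(1) show False by linarith
    next
      case 3
      have "u ! 0 = Suc (\<delta> 1)" using u[of 0] high[of "length v"] 3 len pos by simp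
      from low[OF uv(1) pos(1) this] m(1) show False by linarith
    qed
  qed
  moreover have "?w \<noteq> []" using k by simp
  moreover have "?w = v" if "?w = insert_word i [] v" for i v using that by (simp add: insert_word_def)
  moreover have "?w = u" if "?w = insert_word i u []" for i u using that by (simp add: insert_word_def)
  ultimately show ?thesis using cl unfolding prime_cliff_def by blast
qed

section \<open>Quadratic relations from repeated first letters\<close>

lemma prime_cliff_singleton:
  fixes \<delta> :: "nat \<Rightarrow> nat"
  shows "a \<le> \<delta> 1 \<Longrightarrow> prime_cliff \<delta> [a]"
proof -
  assume "a \<le> \<delta> 1"
  then have "[a] \<in> cliffs \<delta>" by (simp add: cliffs_iff_shifted_cliff shifted_cliff_def)
  moreover have "(u, v) \<in> {([a], []), ([], [a])}" if "[a] = insert_word i u v" for i u v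
  proof -
    have "length (insert_word i u v) = 1" using that by (metis length_Cons list.size(3) One_nat_def)
    then have "u = [] \<or> v = []" by (cases u; cases v) (auto simp: insert_word_def)
    then show ?thesis using that by (auto simp: insert_word_def)
  qed
  ultimately show ?thesis by (auto simp: prime_cliff_def)
qed

text \<open>Inserting \<open>a\<close> before or after the initial \<open>a\<close> yields the same
  word, so two distinct two-node trees have equal values and their difference is a relation.
  Generators of arities \<open>length w + 2\<close> and 2 compose to arity
  \<open>length w + 3\<close>.\<close>

lemma quadratic_relation:
  fixes \<delta> :: "nat \<Rightarrow> nat"
  assumes U: "unimodal \<delta>" and p: "prime_cliff \<delta> (a # w)" and a: "a \<le> \<delta> 1"
  defines "n \<equiv> length w + 3"
  shows "\<exists>f\<in>nontrivial_relations \<delta> n \<inter> component (free_operad (cliff_generators \<delta>)) n.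
    \<exists>t\<in>Poly_Mapping.keys (f :: (nat list \<Rightarrow>\<^sub>0 'k::field) stree \<Rightarrow>\<^sub>0 'k). nodes t = 2"
proof -
  interpret ns_operad "cliff_operad \<delta> :: ('k, _) operad_data" by (rule cliff_operad_ns_operad[OF U])
  let ?C = "\<lambda>w :: nat list. Node (Poly_Mapping.single w (1::'k)) (replicate (cliff_size w) Leaf)"
  define t where "t = (\<lambda>i. graft i (?C (a # w)) (?C [a]))"
  have leaves_C: "leaves (?C x) = cliff_size x" for x by (simp add: sum_list_replicate)
  have i: "i \<le> leaves (?C (a # w))" if "i \<in> {1, 2}" for i
    using that unfolding leaves_C by (auto simp: cliff_size_def)
  have syn: "syntax_tree (cliff_generators \<delta>) (?C (a # w))" "syntax_tree (cliff_generators \<delta>) (?C [a])"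
    using p prime_cliff_singleton[of a \<delta>] a syntax_tree_cliff_corolla by blast+
  have t_syn: "syntax_tree (cliff_generators \<delta>) (t i)" for i
    unfolding t_def by (rule syntax_tree_graft(1)[OF syn])
  have t_leaves: "leaves (t i) = n" if "i \<in> {1, 2}" for i
    using leaves_graft(1)[OF _ i[OF that], of "?C [a]"] that
    unfolding t_def leaves_C by (auto simp: cliff_size_def n_def)
  have t_nodes: "nodes (t 1) = 2"
    using nodes_graft(1)[OF _ i, of 1 "?C [a]"] unfolding t_def
    by (simp add: sum_list_replicate)
  \<comment> \<open>The corolla of \<open>a # w\<close> has at least two leaves, and the second
    generator hangs from the first or from the second.\<close>
  have "t 1 \<noteq> t 2"
    by (simp add: t_def cliff_size_def numeral_2_eq_2)
  have eval: "eval_tree (cliff_operad \<delta>) (t i) = pcomp (cliff_operad \<delta>) i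
      (Poly_Mapping.single (a # w) 1) (Poly_Mapping.single [a] (1::'k))" if "i \<in> {1, 2}" for i
    using eval_graft[OF cliff_generators_subset syn(2) syn(1) _ i[OF that]] that
      eval_tree_cliff_corolla[OF U p, where 'k='k]
      eval_tree_cliff_corolla[OF U prime_cliff_singleton[of a \<delta>, OF a], where 'k='k]
    unfolding t_def by auto
  have "insert_word i (a # w) [a] = a # a # w" if "i \<in> {1, 2}" for i
    using that by (auto simp: insert_word_def)
  \<comment> \<open>Whether the longer word is a cliff need not be decided: both values are that
    word or both are zero.\<close>
  then have "eval_tree (cliff_operad \<delta>) (t i) =
      (if a # a # w \<in> cliffs \<delta> then Poly_Mapping.single (a # a # w) (1::'k) else 0)" if "i \<in> {1, 2}" for i
    using eval[OF that] that by (simp add: pcomp_cliff_operad bilinear_ext_single)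
  from this[of 1] this[of 2]
  have eq: "eval_tree (cliff_operad \<delta>) (t 1) = (eval_tree (cliff_operad \<delta>) (t 2) :: _ \<Rightarrow>\<^sub>0 'k)"
    by simp
  define f where "f = Poly_Mapping.single (t 1) (1::'k) + Poly_Mapping.single (t 2) (- 1)"
  have "Poly_Mapping.keys f \<subseteq> {t 1, t 2}"
    unfolding f_def using keys_add by (force split: if_splits)
  then have f: "f \<in> component (free_operad (cliff_generators \<delta>)) n"
    using t_syn t_leaves by (auto simp: component_free_operad)
  have "canonical_morphism (cliff_operad \<delta>) f = 0"
  proof -
    interpret V: vector_space "pm_scale :: 'k \<Rightarrow> (nat list \<Rightarrow>\<^sub>0 'k) \<Rightarrow> _" by (rule vector_space_pm_scale)
    show ?thesis unfolding f_def canonical_morphism_def scale_cliff_operad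
      by (simp add: linear_ext_add[OF vector_space_pm_scale] linear_ext_single[OF vector_space_pm_scale] eq
          del: One_nat_def)
  qed
  moreover have "t 1 \<in> Poly_Mapping.keys f"
    using \<open>t 1 \<noteq> t 2\<close> by (simp add: f_def in_keys_iff lookup_add lookup_single)
  ultimately show ?thesis
    using f t_nodes by (auto simp: nontrivial_relations_def relations_def)
qed

theorem proposition2p3p4:
  fixes \<delta> :: "nat \<Rightarrow> nat"
  assumes "unimodal \<delta>"
    and "\<not> one_dominated \<delta>"
  shows "\<not> finitely_generated_ideal (free_operad (cliff_generators \<delta>))
           (nontrivial_relations \<delta> ::
             nat \<Rightarrow> ((nat list \<Rightarrow>\<^sub>0 'k) stree \<Rightarrow>\<^sub>0 'k::field_char_0) set)"
proof (rule not_finitely_generated_idealI)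
  show "2 \<le> nodes t" if "f \<in> nontrivial_relations \<delta> n" "t \<in> Poly_Mapping.keys f"
    for n t and f :: "(nat list \<Rightarrow>\<^sub>0 'k) stree \<Rightarrow>\<^sub>0 'k"
    using nontrivial_relations_nodes[OF assms(1) that] .
next
  fix N
  obtain m where m: "2 \<le> m" "\<And>i. 1 \<le> i \<Longrightarrow> i < m \<Longrightarrow> \<delta> i \<le> \<delta> 1" "\<And>i. m \<le> i \<Longrightarrow> \<delta> 1 < \<delta> i"
    using first_exceeding_position[OF assms] by blast
  \<comment> \<open>One of the \<open>m - 1\<close> zeros is split off as the head that gets
    doubled, and \<open>Suc N\<close> high letters push the arity beyond \<open>N\<close>.\<close>
  let ?w = "replicate (m - 2) 0 @ replicate (Suc N) (Suc (\<delta> 1))"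
  have "m - 1 = Suc (m - 2)" using m(1) by simp
  then have "prime_cliff \<delta> (0 # ?w)"
    using prime_cliff_replicate[of m \<delta> "Suc N", OF m] by simp
  from quadratic_relation[OF assms(1) this]
  show "\<exists>n\<ge>N. \<exists>f\<in>nontrivial_relations \<delta> n \<inter> component (free_operad (cliff_generators \<delta>)) n.
      \<exists>t\<in>Poly_Mapping.keys (f :: (nat list \<Rightarrow>\<^sub>0 'k) stree \<Rightarrow>\<^sub>0 'k). nodes t = 2"
    by (intro exI[of _ "length ?w + 3"]) simp
qed

end
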